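(* Let $K$ be a finite simplicial complex with $n$ vertices and let $d\ge0$ be an integer. The wreath product of the automorphism groups $\operatorname{Aut}\partial\Delta_d\wr\operatorname{Aut} K=(S_{d+1})^n\rtimes\operatorname{Aut} K$, taken with respect to the natural action of $\operatorname{Aut} K$ on the $n$ vertices of $K$, acts as a group of automorphisms of the wreath product $\partial\Delta_d\wr K$. In particular, if $\operatorname{Aut} K$ acts transitively on the set of vertices of $K$, then $\partial\Delta_d\wr K$ also admits a vertex-transitive group of automorphisms.
   Context: Simplicial complexes are finite abstract simplicial complexes. $\operatorname{Aut}$ denotes the group of simplicial automorphisms, and $S_{d+1}$ is the symmetric group on $d+1$ letters. Wreath product: let $K$ have vertices $v_1,\dots,v_n$ and let $\Delta_d$ be an abstract $d$-simplex ($d+1$ vertices). The simplicial complex $\partial\Delta_d\wr K$ has as vertices $d+1$ copies $v_k^1,\dots,v_k^{d+1}$ of each vertex $v_k$ of $K$ ($1\le k\le n$). Its facets are exactly the sets obtained as follows: choose a facet $F$ of $K$; take all $d+1$ copies of every vertex $v\in F$, and for every vertex $v\notin F$ take all copies of $v$ except exactly one (arbitrarily chosen) copy. The action on vertices is the natural one: the $k$-th factor $S_{d+1}$ permutes the copies $v_k^1,\dots,v_k^{d+1}$ of $v_k$, and $\operatorname{Aut}K$ permutes the lower indices. *)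

theory Defs
  imports "HOL-Algebra.Algebra"
begin

section \<open>Finite abstract simplicial complexes\<close>

text \<open>A complex is given by its set of faces, including the empty face. The void complex
  (no faces at all) is not excluded.\<close>

definition finite_complex :: "'a set set \<Rightarrow> bool" where
  "finite_complex K \<longleftrightarrow> finite K \<and> (\<forall>\<sigma>\<in>K. finite \<sigma>) \<and> (\<forall>\<sigma>\<in>K. \<forall>\<tau>. \<tau> \<subseteq> \<sigma> \<longrightarrow> \<tau> \<in> K)"

definition vertices :: "'a set set \<Rightarrow> 'a set" where
  "vertices K = \<Union>K"

definition facets :: "'a set set \<Rightarrow> 'a set set" where
  "facets K = {F \<in> K. \<forall>G\<in>K. F \<subseteq> G \<longrightarrow> F = G}"

definition simplicial_map :: "'a set set \<Rightarrow> 'b set set \<Rightarrow> ('a \<Rightarrow> 'b) \<Rightarrow> bool" where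
  "simplicial_map K L f \<longleftrightarrow> (\<forall>\<sigma>\<in>K. f ` \<sigma> \<in> L)"

text \<open>As in \<^const>\<open>sym_group\<close>, a permutation of the vertex set is represented by a function
  on the whole type that is the identity off the vertex set.\<close>

definition aut_group :: "'a set set \<Rightarrow> ('a \<Rightarrow> 'a) monoid" where
  "aut_group K =
     \<lparr> carrier = {p. p permutes vertices K \<and> simplicial_map K K p \<and> simplicial_map K K (inv_into UNIV p)},
       monoid.mult = (\<circ>), one = id \<rparr>"

text \<open>The action of the automorphism group on vertices; the restriction is
  required because \<^const>\<open>BijGroup\<close> consists of extensional functions.\<close>

definition aut_action :: "'a set set \<Rightarrow> ('a \<Rightarrow> 'a) \<Rightarrow> 'a \<Rightarrow> 'a" where
  "aut_action K p = restrict p (vertices K)"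

text \<open>The boundary of the \<open>d\<close>-simplex with vertices \<open>1, \<dots>, d + 1\<close>. For \<open>d = 0\<close> it is the
  complex whose only face is the empty one, with no vertices.\<close>

definition bd_simplex :: "nat \<Rightarrow> nat set set" where
  "bd_simplex d = {\<sigma>. \<sigma> \<subset> {1..d+1}}"


section \<open>Semidirect and wreath products of groups\<close>

definition semidirect ::
  "('a, 'm) monoid_scheme \<Rightarrow> ('b, 'n) monoid_scheme \<Rightarrow> ('b \<Rightarrow> 'a \<Rightarrow> 'a) \<Rightarrow> ('a \<times> 'b) monoid" where
  "semidirect N H \<theta> =
     \<lparr> carrier = carrier N \<times> carrier H,
       monoid.mult = (\<lambda>(a, g) (b, h). (a \<otimes>\<^bsub>N\<^esub> \<theta> g b, g \<otimes>\<^bsub>H\<^esub> h)),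
       one = (\<one>\<^bsub>N\<^esub>, \<one>\<^bsub>H\<^esub>) \<rparr>"

text \<open>If \<open>H\<close> acts on \<open>I\<close> through \<open>\<phi>\<close>, it acts from the left on families indexed by \<open>I\<close>
  by moving the entry at \<open>i\<close> to the place \<open>\<phi> h i\<close>.\<close>

definition coord_action ::
  "('b, 'n) monoid_scheme \<Rightarrow> 'i set \<Rightarrow> ('b \<Rightarrow> 'i \<Rightarrow> 'i) \<Rightarrow> 'b \<Rightarrow> ('i \<Rightarrow> 'c) \<Rightarrow> 'i \<Rightarrow> 'c" where
  "coord_action H I \<phi> h f = (\<lambda>i\<in>I. f (\<phi> (inv\<^bsub>H\<^esub> h) i))"

definition wreath_group ::
  "('c, 'm) monoid_scheme \<Rightarrow> ('b, 'n) monoid_scheme \<Rightarrow> 'i set \<Rightarrow> ('b \<Rightarrow> 'i \<Rightarrow> 'i)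
    \<Rightarrow> (('i \<Rightarrow> 'c) \<times> 'b) monoid" where
  "wreath_group A H I \<phi> = semidirect (product_group I (\<lambda>_. A)) H (coord_action H I \<phi>)"


section \<open>The wreath product of the boundary of a simplex with a complex\<close>

text \<open>The pair \<open>(v, i)\<close> is the \<open>i\<close>-th copy of the vertex \<open>v\<close>. For a vertex \<open>v\<close> outside the
  facet \<open>F\<close>, \<open>c v\<close> is the index of the copy that is left out.\<close>

definition wreath_facet :: "nat \<Rightarrow> 'a set set \<Rightarrow> 'a set \<Rightarrow> ('a \<Rightarrow> nat) \<Rightarrow> ('a \<times> nat) set" where
  "wreath_facet d K F c =
     (SIGMA v : vertices K. if v \<in> F then {1..d+1} else {1..d+1} - {c v})"

definition wreath_facets :: "nat \<Rightarrow> 'a set set \<Rightarrow> ('a \<times> nat) set set" where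
  "wreath_facets d K =
     {wreath_facet d K F c | F c. F \<in> facets K \<and> c \<in> vertices K - F \<rightarrow> {1..d+1}}"

definition wreath_complex :: "nat \<Rightarrow> 'a set set \<Rightarrow> ('a \<times> nat) set set" where
  "wreath_complex d K = {\<sigma>. \<exists>S\<in>wreath_facets d K. \<sigma> \<subseteq> S}"

text \<open>A pair \<open>(f, h)\<close> first permutes the vertices of \<open>K\<close> by \<open>h\<close> and then the copies of each
  vertex \<open>w\<close> by \<open>f w\<close>.\<close>

definition wreath_action ::
  "nat \<Rightarrow> 'a set set \<Rightarrow> ('a \<Rightarrow> nat \<Rightarrow> nat) \<times> ('a \<Rightarrow> 'a) \<Rightarrow> 'a \<times> nat \<Rightarrow> 'a \<times> nat" where
  "wreath_action d K = (\<lambda>(f, h) (v, i).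
     if v \<in> vertices K \<and> i \<in> {1..d+1} then (h v, f (h v) i) else (v, i))"


section \<open>The definition of the wreath product is as intended\<close>

lemma ex_facet:
  assumes "finite_complex K" "\<sigma> \<in> K"
  obtains F where "F \<in> facets K" "\<sigma> \<subseteq> F"
proof -
  have "finite K" using assms unfolding finite_complex_def by blast
  from finite_has_maximal2[OF this assms(2)] obtain F where
    "F \<in> K" "\<sigma> \<subseteq> F" "\<forall>G\<in>K. F \<subseteq> G \<longrightarrow> F = G" by auto
  then show ?thesis using that unfolding facets_def by blast
qed

lemma finite_vertices: "finite_complex K \<Longrightarrow> finite (vertices K)"
  unfolding finite_complex_def vertices_def by auto

lemma facet_subset_vertices: "F \<in> facets K \<Longrightarrow> F \<subseteq> vertices K"
  unfolding facets_def vertices_def by auto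

lemma wreath_facet_subset: "wreath_facet d K F c \<subseteq> vertices K \<times> {1..d+1}"
  unfolding wreath_facet_def by (auto split: if_splits)

lemma wreath_complex_subset:
  assumes "\<sigma> \<in> wreath_complex d K"
  shows "\<sigma> \<subseteq> vertices K \<times> {1..d+1}"
proof -
  obtain F c where "\<sigma> \<subseteq> wreath_facet d K F c"
    using assms unfolding wreath_complex_def wreath_facets_def by blast
  then show ?thesis using wreath_facet_subset by (rule subset_trans)
qed

lemma vertices_wreath_complex:
  assumes "finite_complex K"
  shows "vertices (wreath_complex d K) = vertices K \<times> {1..d+1}"
proof
  show "vertices (wreath_complex d K) \<subseteq> vertices K \<times> {1..d+1}"
    unfolding vertices_def[of "wreath_complex d K"] using wreath_complex_subset by blast
next
  show "vertices K \<times> {1..d+1} \<subseteq> vertices (wreath_complex d K)"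
  proof (rule subrelI)
    fix v i assume vi: "(v, i) \<in> vertices K \<times> {1..d+1}"
    then obtain \<sigma> where "\<sigma> \<in> K" "v \<in> \<sigma>" unfolding vertices_def by blast
    then obtain F where F: "F \<in> facets K" "v \<in> F" using ex_facet[OF assms] by blast
    define S where "S = wreath_facet d K F (\<lambda>_. 1)"
    have "S \<in> wreath_facets d K" unfolding S_def wreath_facets_def using F(1) by fastforce
    moreover have "(v, i) \<in> S" unfolding S_def wreath_facet_def using vi F by auto
    ultimately show "(v, i) \<in> vertices (wreath_complex d K)"
      unfolding vertices_def wreath_complex_def by blast
  qed
qed

lemma finite_complex_wreath_complex:
  assumes "finite_complex K"
  shows "finite_complex (wreath_complex d K)"
proof -
  have fin: "finite (vertices K \<times> {1..d+1})" using finite_vertices[OF assms] by auto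
  have sub: "\<sigma> \<subseteq> vertices K \<times> {1..d+1}" if "\<sigma> \<in> wreath_complex d K" for \<sigma>
    using that vertices_wreath_complex[OF assms, of d] unfolding vertices_def by blast
  then have "wreath_complex d K \<subseteq> Pow (vertices K \<times> {1..d+1})" by auto
  then have "finite (wreath_complex d K)" using fin finite_subset by blast
  moreover have "\<forall>\<sigma>\<in>wreath_complex d K. finite \<sigma>" using sub fin finite_subset by blast
  moreover have "\<forall>\<sigma>\<in>wreath_complex d K. \<forall>\<tau>. \<tau> \<subseteq> \<sigma> \<longrightarrow> \<tau> \<in> wreath_complex d K"
    unfolding wreath_complex_def by blast
  ultimately show ?thesis unfolding finite_complex_def by blast
qed

lemma wreath_facets_incomparable:
  assumes "S \<in> wreath_facets d K" "T \<in> wreath_facets d K" "S \<subseteq> T"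
  shows "S = T"
proof -
  obtain F c where S: "S = wreath_facet d K F c"
    and F: "F \<in> facets K" and c: "c \<in> vertices K - F \<rightarrow> {1..d+1}"
    using assms(1) unfolding wreath_facets_def by blast
  obtain G e where T: "T = wreath_facet d K G e"
    and G: "G \<in> facets K" and e: "e \<in> vertices K - G \<rightarrow> {1..d+1}"
    using assms(2) unfolding wreath_facets_def by blast
  have "F \<subseteq> G"
  proof (rule subsetI, rule ccontr)
    fix v assume v: "v \<in> F" "v \<notin> G"
    then have "v \<in> vertices K" using facet_subset_vertices[OF F] by blast
    then have "(v, e v) \<in> S" "(v, e v) \<notin> T"
      using v e unfolding S T wreath_facet_def by auto
    then show False using assms(3) by blast
  qed
  then have FG: "F = G" using F G unfolding facets_def by blast
  have "c v = e v" if v: "v \<in> vertices K" "v \<notin> F" for v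
  proof (rule ccontr)
    assume "c v \<noteq> e v"
    then have "(v, e v) \<in> S" "(v, e v) \<notin> T"
      using v e FG unfolding S T wreath_facet_def by auto
    then show False using assms(3) by blast
  qed
  then show ?thesis unfolding S T wreath_facet_def FG[symmetric] by (auto split: if_splits)
qed

lemma facets_wreath_complex: "facets (wreath_complex d K) = wreath_facets d K"
proof
  show "facets (wreath_complex d K) \<subseteq> wreath_facets d K"
    unfolding facets_def wreath_complex_def by blast
next
  show "wreath_facets d K \<subseteq> facets (wreath_complex d K)"
  proof
    fix S assume S: "S \<in> wreath_facets d K"
    have "S = G" if G: "G \<in> wreath_complex d K" "S \<subseteq> G" for G
    proof -
      obtain T where T: "T \<in> wreath_facets d K" "G \<subseteq> T"
        using G(1) unfolding wreath_complex_def by blast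
      then have "S = T" using wreath_facets_incomparable[OF S T(1)] G(2) by blast
      then show ?thesis using G(2) T(2) by blast
    qed
    then show "S \<in> facets (wreath_complex d K)"
      using S unfolding facets_def wreath_complex_def by blast
  qed
qed

end

theory Submission
  imports Defs
begin

text \<open>
  A pair \<open>(f, h)\<close> sends the facet over \<open>F\<close> that leaves out the copy \<open>c v\<close> of each \<open>v\<close> outside \<open>F\<close>
  to the facet over the image of \<open>F\<close> under \<open>h\<close> that leaves out the copy \<open>f (h v) (c v)\<close> of \<open>h v\<close>.
  Hence the action is by simplicial maps, and since it is multiplicative, the inverse of such a
  map is again the action of a group element. Transitivity follows by first moving the vertex
  of \<open>K\<close> and then transposing two of its copies.
\<close>

section \<open>Automorphism groups of complexes\<close>

lemma aut_group_carrierD: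
  assumes "p \<in> carrier (aut_group K)"
  shows "p permutes vertices K" "simplicial_map K K p" "simplicial_map K K (inv_into UNIV p)"
  using assms by (simp_all add: aut_group_def)

lemma aut_group_mult [simp]: "p \<otimes>\<^bsub>aut_group K\<^esub> q = p \<circ> q"
  and aut_group_one [simp]: "\<one>\<^bsub>aut_group K\<^esub> = id"
  by (simp_all add: aut_group_def)

lemma simplicial_map_id: "simplicial_map K K id"
  by (simp add: simplicial_map_def)

lemma simplicial_map_comp:
  "simplicial_map K L f \<Longrightarrow> simplicial_map L M g \<Longrightarrow> simplicial_map K M (g \<circ> f)"
  unfolding simplicial_map_def by (metis image_comp)

lemma aut_group_closed:
  assumes "p \<in> carrier (aut_group K)" "q \<in> carrier (aut_group K)"
  shows "p \<circ> q \<in> carrier (aut_group K)"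
proof -
  note p = aut_group_carrierD[OF assms(1)] and q = aut_group_carrierD[OF assms(2)]
  have "inv_into UNIV (p \<circ> q) = inv_into UNIV q \<circ> inv_into UNIV p"
    using p(1) q(1) by (simp add: o_inv_distrib permutes_bij)
  then show ?thesis
    using p q by (simp add: aut_group_def permutes_compose simplicial_map_comp)
qed

lemma aut_group_inv_closed:
  assumes "p \<in> carrier (aut_group K)"
  shows "inv_into UNIV p \<in> carrier (aut_group K)"
  using aut_group_carrierD[OF assms]
  by (simp add: aut_group_def permutes_inv permutes_inv_inv)

lemma group_aut_group: "group (aut_group K)"
proof (rule groupI)
  show "\<one>\<^bsub>aut_group K\<^esub> \<in> carrier (aut_group K)"
    by (simp add: aut_group_def simplicial_map_id permutes_id)
next
  fix p assume p: "p \<in> carrier (aut_group K)"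
  then show "\<exists>q\<in>carrier (aut_group K). q \<otimes>\<^bsub>aut_group K\<^esub> p = \<one>\<^bsub>aut_group K\<^esub>"
    using aut_group_inv_closed[OF p] permutes_inv_o(2)[OF aut_group_carrierD(1)[OF p]] by auto
qed (auto simp: aut_group_closed comp_assoc)

text \<open>The factor action \<open>coord_action\<close> is defined through the abstract group
  inverse; this makes it computable as the inverse function.\<close>

lemma aut_group_inv:
  assumes "p \<in> carrier (aut_group K)"
  shows "inv\<^bsub>aut_group K\<^esub> p = inv_into UNIV p"
  using group.inv_equality[OF group_aut_group _ assms aut_group_inv_closed[OF assms]]
    permutes_inv_o(2)[OF aut_group_carrierD(1)[OF assms]] by simp

lemma group_action_aut_action: "group_action (aut_group K) (vertices K) (aut_action K)"
proof -
  have "aut_action K p \<in> Bij (vertices K)" if "p \<in> carrier (aut_group K)" for p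
    using permutes_imp_bij[OF aut_group_carrierD(1)[OF that]]
    by (simp add: aut_action_def Bij_def)
  \<comment> \<open>Multiplication in \<open>BijGroup\<close> is composition restricted to the
    vertex set. It agrees with restricting \<open>p \<circ> q\<close> since \<open>q\<close> maps
    vertices to vertices.\<close>
  moreover have "aut_action K (p \<circ> q) = compose (vertices K) (aut_action K p) (aut_action K q)"
    if "q \<in> carrier (aut_group K)" for p q
    using permutes_in_image[OF aut_group_carrierD(1)[OF that]]
    by (auto simp: aut_action_def compose_def)
  ultimately have "aut_action K \<in> hom (aut_group K) (BijGroup (vertices K))"
    by (auto simp: hom_def BijGroup_def)
  then show ?thesis
    by (simp add: group_action_def group_hom_def group_hom_axioms_def group_aut_group group_BijGroup)
qed

text \<open>Maximality is carried back by the inverse, which is simplicial too: a face above the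
  image of \<open>F\<close> pulls back to a face above \<open>F\<close>, and that face is
  \<open>F\<close> itself.\<close>

lemma facets_image:
  assumes "p \<in> carrier (aut_group K)" "F \<in> facets K"
  shows "p ` F \<in> facets K"
proof -
  note p = aut_group_carrierD[OF assms(1)]
  have "F \<in> K" and max: "\<And>G. G \<in> K \<Longrightarrow> F \<subseteq> G \<Longrightarrow> F = G"
    using assms(2) unfolding facets_def by auto
  have "p ` F = G" if "G \<in> K" "p ` F \<subseteq> G" for G
  proof -
    have "inv_into UNIV p ` p ` F = F"
      using permutes_inj[OF p(1)] by (simp add: image_image)
    then have "F \<subseteq> inv_into UNIV p ` G"
      using image_mono[OF that(2), of "inv_into UNIV p"] by simp
    then have "F = inv_into UNIV p ` G"
      using max p(3) \<open>G \<in> K\<close> by (simp add: simplicial_map_def)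
    then show ?thesis
      using permutes_surj[OF p(1)] by (simp add: image_image surj_f_inv_f)
  qed
  then show ?thesis
    using p(2) \<open>F \<in> K\<close> unfolding facets_def simplicial_map_def by blast
qed

section \<open>Automorphisms of the boundary of a simplex\<close>

lemma vertices_bd_simplex: "vertices (bd_simplex d) = (if d = 0 then {} else {1..d+1})"
proof (cases "d = 0")
  case True
  then show ?thesis by (auto simp: vertices_def bd_simplex_def)
next
  case False
  have "i \<in> vertices (bd_simplex d)" if "i \<in> {1..d+1}" for i
  proof -
    \<comment> \<open>For positive \<open>d\<close> a single vertex is a proper subset of the
      simplex, as 1 differs from \<open>d + 1\<close>; for \<open>d = 0\<close> it is the whole
      simplex and drops out of the boundary.\<close>
    have "card {i} \<noteq> card {1..d+1}" using False by simp
    then have "{i} \<noteq> {1..d+1}" by metis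
    then have "{i} \<in> bd_simplex d" using that by (auto simp: bd_simplex_def)
    then show ?thesis unfolding vertices_def by blast
  qed
  then show ?thesis using False by (auto simp: vertices_def bd_simplex_def)
qed

text \<open>Injective images preserve strict inclusion, and the full simplex is its own
  image.\<close>

lemma simplicial_map_bd_simplex:
  assumes "p permutes {1..d+1}"
  shows "simplicial_map (bd_simplex d) (bd_simplex d) p"
  unfolding simplicial_map_def bd_simplex_def
proof
  fix \<sigma> assume "\<sigma> \<in> {\<sigma>. \<sigma> \<subset> {1..d+1}}"
  then have "p ` \<sigma> \<subset> p ` {1..d+1}"
    by (intro image_strict_mono permutes_inj_on[OF assms]) simp
  then show "p ` \<sigma> \<in> {\<sigma>. \<sigma> \<subset> {1..d+1}}"
    unfolding permutes_image[OF assms] by simp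
qed

text \<open>For \<open>d = 0\<close> the boundary has no vertices, so both groups are trivial.\<close>

lemma aut_group_bd_simplex: "aut_group (bd_simplex d) = sym_group (d + 1)"
proof -
  have "p permutes vertices (bd_simplex d) \<longleftrightarrow> p permutes {1..d+1}" for p
    by (simp add: vertices_bd_simplex)
  then show ?thesis
    unfolding aut_group_def sym_group_def
    by (auto simp del: One_nat_def intro: simplicial_map_bd_simplex permutes_inv)
qed


section \<open>Wreath products of groups\<close>

lemma wreath_group_carrier [simp]:
  "carrier (wreath_group A H I \<phi>) = (I \<rightarrow>\<^sub>E carrier A) \<times> carrier H"
  and wreath_group_one [simp]: "\<one>\<^bsub>wreath_group A H I \<phi>\<^esub> = (\<lambda>i\<in>I. \<one>\<^bsub>A\<^esub>, \<one>\<^bsub>H\<^esub>)"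
  and wreath_group_mult [simp]: "(a, g) \<otimes>\<^bsub>wreath_group A H I \<phi>\<^esub> (b, h) =
    (\<lambda>i\<in>I. a i \<otimes>\<^bsub>A\<^esub> b (\<phi> (inv\<^bsub>H\<^esub> g) i), g \<otimes>\<^bsub>H\<^esub> h)"
  by (auto simp: wreath_group_def semidirect_def coord_action_def)

lemma group_wreath_group:
  assumes "group A" "group_action H I \<phi>"
  shows "group (wreath_group A H I \<phi>)"
proof -
  interpret A: group A by fact
  interpret \<phi>: group_action H I \<phi> by fact
  interpret H: group H using \<phi>.group_hom by (simp add: group_hom_def)
  have in_I: "\<phi> g i \<in> I" if "g \<in> carrier H" "i \<in> I" for g i
    using \<phi>.element_image that by blast
  have in_A: "a i \<in> carrier A" if "a \<in> I \<rightarrow>\<^sub>E carrier A" "i \<in> I" for a i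
    using that by (rule PiE_mem)
  have one: "\<phi> \<one>\<^bsub>H\<^esub> i = i" if "i \<in> I" for i
    using \<phi>.id_eq_one that by (metis restrict_apply')
  show ?thesis
  proof (rule groupI)
    fix x y assume "x \<in> carrier (wreath_group A H I \<phi>)" "y \<in> carrier (wreath_group A H I \<phi>)"
    then show "x \<otimes>\<^bsub>wreath_group A H I \<phi>\<^esub> y \<in> carrier (wreath_group A H I \<phi>)"
      by (cases x; cases y) (auto simp: in_I in_A)
  next
    show "\<one>\<^bsub>wreath_group A H I \<phi>\<^esub> \<in> carrier (wreath_group A H I \<phi>)"
      by simp
  next
    fix x y z
    assume "x \<in> carrier (wreath_group A H I \<phi>)" "y \<in> carrier (wreath_group A H I \<phi>)"
      "z \<in> carrier (wreath_group A H I \<phi>)"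
    then show "x \<otimes>\<^bsub>wreath_group A H I \<phi>\<^esub> y \<otimes>\<^bsub>wreath_group A H I \<phi>\<^esub> z =
      x \<otimes>\<^bsub>wreath_group A H I \<phi>\<^esub> (y \<otimes>\<^bsub>wreath_group A H I \<phi>\<^esub> z)"
      \<comment> \<open>The third family is shifted by the inverse of a product on one side and by
        two successive inverses on the other; these agree as inversion reverses products.\<close>
      by (cases x; cases y; cases z)
        (auto simp: fun_eq_iff in_I in_A A.m_assoc H.m_assoc H.inv_mult_group \<phi>.composition_rule)
  next
    fix x assume "x \<in> carrier (wreath_group A H I \<phi>)"
    then obtain a g where x: "x = (a, g)" "a \<in> I \<rightarrow>\<^sub>E carrier A" "g \<in> carrier H"
      by auto
    \<comment> \<open>The unit acts trivially on \<open>I\<close>, so the shift leaves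
      \<open>a\<close> unchanged there; outside \<open>I\<close> extensionality of \<open>a\<close>
      settles equality.\<close>
    then have "(\<lambda>i\<in>I. \<one>\<^bsub>A\<^esub> \<otimes>\<^bsub>A\<^esub> a (\<phi> \<one>\<^bsub>H\<^esub> i)) = restrict a I"
      by (intro restrict_ext) (simp add: one in_A)
    then have "(\<lambda>i\<in>I. (\<lambda>i\<in>I. \<one>\<^bsub>A\<^esub>) i \<otimes>\<^bsub>A\<^esub> a (\<phi> (inv\<^bsub>H\<^esub> \<one>\<^bsub>H\<^esub>) i)) = a"
      using PiE_restrict[OF x(2)] by (simp cong: restrict_cong)
    then show "\<one>\<^bsub>wreath_group A H I \<phi>\<^esub> \<otimes>\<^bsub>wreath_group A H I \<phi>\<^esub> x = x"
      using x by simp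
  next
    fix x assume "x \<in> carrier (wreath_group A H I \<phi>)"
    then obtain a g where x: "x = (a, g)" "a \<in> I \<rightarrow>\<^sub>E carrier A" "g \<in> carrier H"
      by auto
    \<comment> \<open>In \<open>y\<close> times \<open>x\<close> the family \<open>a\<close> is
      shifted by the inverse of \<open>inv g\<close>, that is by \<open>g\<close>. The entry of
      \<open>y\<close> at \<open>i\<close> therefore has to cancel
      \<open>a (\<phi> g i)\<close>.\<close>
    define y where "y = (\<lambda>i\<in>I. inv\<^bsub>A\<^esub> a (\<phi> g i), inv\<^bsub>H\<^esub> g)"
    have "y \<in> carrier (wreath_group A H I \<phi>)"
      using x by (auto simp: y_def in_I in_A)
    moreover have "y \<otimes>\<^bsub>wreath_group A H I \<phi>\<^esub> x = \<one>\<^bsub>wreath_group A H I \<phi>\<^esub>"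
      using x by (auto simp: y_def in_I in_A fun_eq_iff)
    ultimately show "\<exists>y\<in>carrier (wreath_group A H I \<phi>).
        y \<otimes>\<^bsub>wreath_group A H I \<phi>\<^esub> x = \<one>\<^bsub>wreath_group A H I \<phi>\<^esub>"
      by blast
  qed
qed


section \<open>The action on the wreath product complex\<close>

text \<open>The base group is written as \<open>sym_group (d + 1)\<close>;
  \<open>aut_group_bd_simplex\<close> identifies it with the automorphism group of the
  boundary.\<close>

context
  fixes d :: nat and K :: "'a set set" and W
  defines "W \<equiv> wreath_group (sym_group (d + 1)) (aut_group K) (vertices K) (aut_action K)"
begin

section \<open>Evaluation and multiplicativity of the action\<close>

lemma W_carrierD:
  assumes "(f, h) \<in> carrier W"
  shows "h \<in> carrier (aut_group K)" "f \<in> extensional (vertices K)"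
    "v \<in> vertices K \<Longrightarrow> f v permutes {1..d+1}"
  using assms by (auto simp: W_def PiE_iff sym_group_def)

lemma group_W: "group W"
  unfolding W_def by (intro group_wreath_group sym_group_is_group group_action_aut_action)

text \<open>The image pair again satisfies the condition in the definition of
  \<open>wreath_action\<close>, so that actions can be evaluated one after another.\<close>

lemma wreath_action_in:
  assumes "(f, h) \<in> carrier W" "v \<in> vertices K" "i \<in> {1..d+1}"
  shows "h v \<in> vertices K" "f (h v) i \<in> {1..d+1}" "wreath_action d K (f, h) (v, i) = (h v, f (h v) i)"
proof -
  show "h v \<in> vertices K"
    using permutes_in_image[OF aut_group_carrierD(1)[OF W_carrierD(1)[OF assms(1)]]] assms(2) by simp
  then show "f (h v) i \<in> {1..d+1}"
    using permutes_in_image[OF W_carrierD(3)[OF assms(1)]] assms(3) by blast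
qed (use assms in \<open>simp add: wreath_action_def\<close>)

lemma wreath_action_out:
  "u \<notin> vertices K \<times> {1..d+1} \<Longrightarrow> wreath_action d K x u = u"
  by (cases x; cases u) (auto simp: wreath_action_def)

text \<open>The product shifts \<open>g\<close> by the inverse of \<open>h\<close>, so its family at
  \<open>h (k v)\<close> is \<open>f (h (k v)) \<circ> g (k v)\<close>, which is the permutation of
  copies met when \<open>y\<close> acts first and \<open>x\<close> second.\<close>

lemma wreath_action_mult:
  assumes "x \<in> carrier W" "y \<in> carrier W"
  shows "wreath_action d K (x \<otimes>\<^bsub>W\<^esub> y) = wreath_action d K x \<circ> wreath_action d K y"
proof
  fix u
  obtain f h g k where x: "x = (f, h)" and y: "y = (g, k)" by (cases x; cases y)
  have hc: "h \<in> carrier (aut_group K)" using W_carrierD(1) assms(1) x by blast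
  note h = aut_group_carrierD(1)[OF hc]
  show "wreath_action d K (x \<otimes>\<^bsub>W\<^esub> y) u = (wreath_action d K x \<circ> wreath_action d K y) u"
  proof (cases "u \<in> vertices K \<times> {1..d+1}")
    case True
    then obtain v i where u: "u = (v, i)" "v \<in> vertices K" "i \<in> {1..d+1}" by blast
    note k = wreath_action_in[OF assms(2)[unfolded y] u(2,3)]
    note hk = wreath_action_in[OF assms(1)[unfolded x] k(1,2)]
    have "wreath_action d K (x \<otimes>\<^bsub>W\<^esub> y) u = (h (k v), f (h (k v)) (g (k v) i))"
      using u hk(1) k(1) hc permutes_inverses(2)[OF h]
      by (simp add: W_def x y wreath_action_def sym_group_def aut_group_inv aut_action_def)
    then show ?thesis using hk(3) k(3) by (simp add: x y u)
  qed (simp add: wreath_action_out)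
qed

lemma wreath_action_one: "wreath_action d K \<one>\<^bsub>W\<^esub> = id"
  by (auto simp: W_def wreath_action_def sym_group_def fun_eq_iff)

section \<open>Simpliciality of the action\<close>

lemma wreath_action_facet:
  assumes "x \<in> carrier W" "S \<in> wreath_facets d K"
  shows "\<exists>T\<in>wreath_facets d K. wreath_action d K x ` S \<subseteq> T"
proof -
  obtain f h where x: "x = (f, h)" by (cases x)
  note W = assms(1)[unfolded x]
  have hc: "h \<in> carrier (aut_group K)" using W_carrierD(1) W by blast
  note h = aut_group_carrierD(1)[OF hc]
  obtain F c where S: "S = wreath_facet d K F c"
    and F: "F \<in> facets K" and c: "c \<in> vertices K - F \<rightarrow> {1..d+1}"
    using assms(2) unfolding wreath_facets_def by blast
  \<comment> \<open>The omitted copies are moved along: \<open>c\<close> is read at the preimage of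
    \<open>w\<close> and then permuted by \<open>f w\<close>.\<close>
  define e where "e w = f w (c (inv_into UNIV h w))" for w
  have eh: "e (h v) = f (h v) (c v)" for v
    using permutes_inverses(2)[OF h] by (simp add: e_def)
  have "e w \<in> {1..d+1}" if "w \<in> vertices K - h ` F" for w
  proof -
    from that have "w \<in> h ` vertices K" "w \<notin> h ` F"
      unfolding permutes_image[OF h] by auto
    then obtain v where v: "w = h v" "v \<in> vertices K" "v \<notin> F"
      by blast
    have "c v \<in> {1..d+1}"
      using c v(2,3) by blast
    then show ?thesis
      unfolding v(1) eh by (rule wreath_action_in(2)[OF W v(2)])
  qed
  then have "wreath_facet d K (h ` F) e \<in> wreath_facets d K"
    using facets_image[OF hc F] unfolding wreath_facets_def by blast
  \<comment> \<open>Inclusion in a facet suffices, since the faces are exactly the subsets of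
    facets.\<close>
  moreover have "wreath_action d K x u \<in> wreath_facet d K (h ` F) e" if "u \<in> S" for u
  proof -
    obtain v i where u: "u = (v, i)" by (cases u)
    have v: "v \<in> vertices K" and i: "i \<in> {1..d+1}" and ci: "v \<notin> F \<Longrightarrow> i \<noteq> c v"
      using that by (auto simp: S u wreath_facet_def split: if_splits)
    note act = wreath_action_in[OF W v i]
    \<comment> \<open>Injectivity of \<open>f (h v)\<close> keeps a copy other than
      \<open>c v\<close> away from the copy omitted at \<open>h v\<close>.\<close>
    have "f (h v) i \<noteq> e (h v)" if "h v \<notin> h ` F"
    proof -
      have "i \<noteq> c v" using ci that by blast
      then show ?thesis
        unfolding eh using inj_eq[OF permutes_inj[OF W_carrierD(3)[OF W act(1)]]] by simp
    qed
    then show ?thesis using act by (simp add: x u wreath_facet_def)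
  qed
  ultimately show ?thesis by blast
qed

lemma simplicial_wreath_action:
  assumes "x \<in> carrier W"
  shows "simplicial_map (wreath_complex d K) (wreath_complex d K) (wreath_action d K x)"
  unfolding simplicial_map_def
proof
  fix \<sigma> assume "\<sigma> \<in> wreath_complex d K"
  then obtain S where S: "S \<in> wreath_facets d K" "\<sigma> \<subseteq> S"
    unfolding wreath_complex_def by blast
  obtain T where T: "T \<in> wreath_facets d K" "wreath_action d K x ` S \<subseteq> T"
    using wreath_action_facet[OF assms S(1)] by blast
  have "wreath_action d K x ` \<sigma> \<subseteq> T"
    using image_mono[OF S(2)] T(2) by (rule subset_trans)
  with T(1) show "wreath_action d K x ` \<sigma> \<in> wreath_complex d K"
    unfolding wreath_complex_def by blast
qed

text \<open>Inverses in \<open>W\<close> give two-sided inverse maps, so bijectivity needs no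
  formula for the inverse. Finiteness of \<open>K\<close> puts each of its vertices in a facet, so
  that all pairs occur as vertices of the wreath product.\<close>

lemma wreath_action_in_aut_group:
  assumes "finite_complex K" "x \<in> carrier W"
  shows "wreath_action d K x \<in> carrier (aut_group (wreath_complex d K))"
proof -
  interpret W: group W by (rule group_W)
  let ?y = "inv\<^bsub>W\<^esub> x"
  have y: "?y \<in> carrier W" using assms(2) by simp
  have comp: "wreath_action d K ?y \<circ> wreath_action d K x = id"
    "wreath_action d K x \<circ> wreath_action d K ?y = id"
    using wreath_action_mult[OF y assms(2)] wreath_action_mult[OF assms(2) y] assms(2)
    by (simp_all add: wreath_action_one)
  have inv: "inv_into UNIV (wreath_action d K x) = wreath_action d K ?y"
    using comp by (rule inv_unique_comp[rotated])
  have "wreath_action d K x permutes vertices (wreath_complex d K)"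
    unfolding vertices_wreath_complex[OF assms(1)] permutes_def
    using o_bij[OF comp] wreath_action_out by (auto simp: bij_iff)
  then show ?thesis
    using simplicial_wreath_action[OF assms(2)] simplicial_wreath_action[OF y]
    by (simp add: aut_group_def inv)
qed

section \<open>The homomorphism, its faithfulness and transitivity\<close>

lemma group_hom_wreath_action:
  assumes "finite_complex K"
  shows "group_hom W (aut_group (wreath_complex d K)) (wreath_action d K)"
proof -
  have "wreath_action d K \<in> hom W (aut_group (wreath_complex d K))"
    using wreath_action_in_aut_group[OF assms] by (intro homI) (simp_all add: wreath_action_mult)
  then show ?thesis
    by (simp add: group_hom_def group_hom_axioms_def group_W group_aut_group)
qed

text \<open>Both components can be read off from the map: the first coordinate gives
  \<open>h\<close>, and since every vertex is some \<open>h v\<close>, the second gives all of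
  \<open>f\<close>.\<close>

lemma inj_on_wreath_action: "inj_on (wreath_action d K) (carrier W)"
proof (rule inj_onI)
  fix x y assume xy: "x \<in> carrier W" "y \<in> carrier W" "wreath_action d K x = wreath_action d K y"
  obtain f h g k where x: "x = (f, h)" and y: "y = (g, k)" by (cases x; cases y)
  note X = xy(1)[unfolded x] and Y = xy(2)[unfolded y]
  note h = aut_group_carrierD(1)[OF W_carrierD(1)[OF X]]
    and k = aut_group_carrierD(1)[OF W_carrierD(1)[OF Y]]
  have eq: "h v = k v \<and> f (h v) i = g (h v) i" if "v \<in> vertices K" "i \<in> {1..d+1}" for v i
    using wreath_action_in(3)[OF X that] wreath_action_in(3)[OF Y that] xy(3) by (auto simp: x y)
  \<comment> \<open>Copy 1 exists for every \<open>d\<close>, including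
    \<open>d = 0\<close>.\<close>
  have "h v = k v" for v
    using eq[of v 1] permutes_not_in[OF h, of v] permutes_not_in[OF k, of v]
    by (cases "v \<in> vertices K") auto
  moreover have "f w i = g w i" if w: "w \<in> vertices K" for w i
  proof (cases "i \<in> {1..d+1}")
    case True
    obtain v where "w = h v" "v \<in> vertices K" using w permutes_image[OF h] by blast
    then show ?thesis using eq True by blast
  next
    case False
    then show ?thesis
      using permutes_not_in[OF W_carrierD(3)[OF X w]] permutes_not_in[OF W_carrierD(3)[OF Y w]] by simp
  qed
  ultimately show "x = y"
    using extensionalityI[OF W_carrierD(2)[OF X] W_carrierD(2)[OF Y]] by (auto simp: x y)
qed

lemma transitive_wreath_action:
  assumes "finite_complex K" "transitive_action (aut_group K) (vertices K) (aut_action K)"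
  shows "transitive_action
    ((aut_group (wreath_complex d K))\<lparr>carrier := wreath_action d K ` carrier W\<rparr>)
    (vertices (wreath_complex d K)) (aut_action (wreath_complex d K))"
    (is "transitive_action (?A\<lparr>carrier := ?H\<rparr>) ?V ?\<alpha>")
proof -
  have sub: "subgroup ?H ?A"
    using group_hom_wreath_action[OF assms(1)] by (rule group_hom.img_is_subgroup)
  have "group_hom ?A (BijGroup ?V) ?\<alpha>"
    using group_action_aut_action by (rule group_action.group_hom)
  then have "group_hom (?A\<lparr>carrier := ?H\<rparr>) (BijGroup ?V) ?\<alpha>"
    using group.subgroup_imp_group[OF group_aut_group sub] subgroup.subset[OF sub]
    by (simp add: group_hom_def group_hom_axioms_def hom_def Pi_iff subset_iff)
  moreover have "\<exists>p\<in>?H. ?\<alpha> p u = u'" if "u \<in> ?V" "u' \<in> ?V" for u u'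
  proof -
    obtain v i w j where u: "u = (v, i)" "v \<in> vertices K" "i \<in> {1..d+1}"
      and u': "u' = (w, j)" "w \<in> vertices K" "j \<in> {1..d+1}"
      using \<open>u \<in> ?V\<close> \<open>u' \<in> ?V\<close> unfolding vertices_wreath_complex[OF assms(1)] by blast
    obtain h where h: "h \<in> carrier (aut_group K)" "h v = w"
      using transitive_action.unique_orbit[OF assms(2) u(2) u'(2)] u(2)
      by (auto simp: aut_action_def)
    \<comment> \<open>Only the entry at \<open>w = h v\<close> acts on \<open>u\<close>; the same
      transposition is placed at every vertex. It is the identity if \<open>i = j\<close>.\<close>
    define x where "x = ((\<lambda>_\<in>vertices K. transpose i j), h)"
    have "x \<in> carrier W"
      using h permutes_swap_id[OF u(3) u'(3)] by (simp add: x_def W_def sym_group_def)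
    moreover have "?\<alpha> (wreath_action d K x) u = u'"
      using u u' h \<open>u \<in> ?V\<close> by (simp add: x_def aut_action_def wreath_action_def)
    ultimately show ?thesis by blast
  qed
  ultimately show ?thesis
    by (simp add: transitive_action_def transitive_action_axioms_def group_action_def)
qed

end

theorem proposition3p9:
  fixes K :: "'a set set" and d :: nat
  assumes "finite_complex K"
  shows "wreath_group (aut_group (bd_simplex d)) (aut_group K) (vertices K) (aut_action K) =
           semidirect (product_group (vertices K) (\<lambda>_. sym_group (d + 1))) (aut_group K)
             (coord_action (aut_group K) (vertices K) (aut_action K))
       \<and> group_hom
           (wreath_group (aut_group (bd_simplex d)) (aut_group K) (vertices K) (aut_action K))
           (aut_group (wreath_complex d K)) (wreath_action d K)
       \<and> inj_on (wreath_action d K)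
           (carrier (wreath_group (aut_group (bd_simplex d)) (aut_group K) (vertices K) (aut_action K)))
       \<and> (transitive_action (aut_group K) (vertices K) (aut_action K) \<longrightarrow>
           (\<exists>H. subgroup H (aut_group (wreath_complex d K)) \<and>
                transitive_action ((aut_group (wreath_complex d K))\<lparr>carrier := H\<rparr>)
                  (vertices (wreath_complex d K)) (aut_action (wreath_complex d K))))"
  \<comment> \<open>With the symmetric group in place, the first conjunct is the definition of the
    wreath product of groups.\<close>
  unfolding aut_group_bd_simplex
proof (intro conjI impI exI)
  show "wreath_group (sym_group (d + 1)) (aut_group K) (vertices K) (aut_action K) =
    semidirect (product_group (vertices K) (\<lambda>_. sym_group (d + 1))) (aut_group K)
      (coord_action (aut_group K) (vertices K) (aut_action K))"
    by (rule wreath_group_def)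
next
  assume "transitive_action (aut_group K) (vertices K) (aut_action K)"
  \<comment> \<open>The witness for the transitive subgroup is the image of the whole wreath
    product.\<close>
  with assms show "transitive_action
      ((aut_group (wreath_complex d K))\<lparr>carrier := wreath_action d K `
        carrier (wreath_group (sym_group (d + 1)) (aut_group K) (vertices K) (aut_action K))\<rparr>)
      (vertices (wreath_complex d K)) (aut_action (wreath_complex d K))"
    by (rule transitive_wreath_action)
qed (rule group_hom_wreath_action[OF assms] inj_on_wreath_action
    group_hom.img_is_subgroup[OF group_hom_wreath_action[OF assms]])+

end
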